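(* Each of the following proof rules is sound, i.e., whenever its premises hold (judgments valid, implications valid, equivalences holding), its conclusion is valid. Here $c,c',d,d'$ are commands, $\mathcal P,\mathcal P',\mathcal Q,\mathcal R,\mathcal S$ relations, $e,e'$ expressions, $q$ an assertion, $x$ a variable, $E$ a two-state expression. (eSkip) $\models\mathsf{skip}\mid\mathsf{skip}:\mathcal R\leadsto_\exists\mathcal R$. (eAsgnSkip) $\models x:=e\mid\mathsf{skip}:\mathcal R[x|/e|]\leadsto_\exists\mathcal R$. (eSkipAsgn) $\models\mathsf{skip}\mid x:=e:\mathcal R[|x/|e]\leadsto_\exists\mathcal R$. (eHavSkip) $\models\mathsf{hav}\ x\mid\mathsf{skip}:(\forall x|.\mathcal R)\leadsto_\exists\mathcal R$. (eSkipHav) $\models\mathsf{skip}\mid\mathsf{hav}\ x:(\exists|x.\mathcal R)\leadsto_\exists\mathcal R$. (eAsrtSkip) $\models\mathsf{assert}\ q\mid\mathsf{skip}:(\mathcal R\wedge[q]_L)\leadsto_\exists\mathcal R$. (eSkipAsrt) $\models\mathsf{skip}\mid\mathsf{assert}\ q:(\mathcal R\wedge[q]_R)\leadsto_\exists\mathcal R$. (eSeq) If $\models c\mid c':\mathcal P\leadsto_\exists\mathcal Q$ and $\models d\mid d':\mathcal Q\leadsto_\exists\mathcal R$ then $\models c;d\mid c';d':\mathcal P\leadsto_\exists\mathcal R$. (eIf4) If $\models c\mid c':(\mathcal Q\wedge[e]_L\wedge[e']_R)\leadsto_\exists\mathcal R$, $\models c\mid d':(\mathcal Q\wedge[e]_L\wedge\neg[e']_R)\leadsto_\exists\mathcal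 R$, $\models d\mid c':(\mathcal Q\wedge\neg[e]_L\wedge[e']_R)\leadsto_\exists\mathcal R$ and $\models d\mid d':(\mathcal Q\wedge\neg[e]_L\wedge\neg[e']_R)\leadsto_\exists\mathcal R$, then $\models\mathsf{if}\ e\ \mathsf{then}\ c\ \mathsf{else}\ d\mid\mathsf{if}\ e'\ \mathsf{then}\ c'\ \mathsf{else}\ d':\mathcal Q\leadsto_\exists\mathcal R$. (eDo) If $\models c\mid\mathsf{skip}:(\mathcal Q\wedge[e]_L\wedge\mathcal P)\leadsto_\exists\mathcal Q$; for every $n\in\mathbb Z$, $\models\mathsf{skip}\mid c':(\mathcal Q\wedge[e']_R\wedge\mathcal P'\wedge(n=E))\leadsto_\exists(\mathcal Q\wedge(0\le E<n))$; $\models c\mid c':(\mathcal Q\wedge[e]_L\wedge[e']_R\wedge\neg\mathcal P\wedge\neg\mathcal P')\leadsto_\exists\mathcal Q$; and $\models\mathcal Q\Rightarrow((e\doteq e')\vee(\mathcal P\wedge[e]_L)\vee(\mathcal P'\wedge[e']_R))$; then $\models\mathsf{while}\ e\ \mathsf{do}\ c\mid\mathsf{while}\ e'\ \mathsf{do}\ c':\mathcal Q\leadsto_\exists(\mathcal Q\wedge\neg[e]_L\wedge\neg[e']_R)$. (eRewrite) If $\models c\mid c':\mathcal Q\leadsto_\exists\mathcal R$, $c\simeq d$ and $c'\simeq d'$, then $\models d\mid d':\mathcal Q\leadsto_\exists\mathcal R$. (eConseq) If $\models\mathcal P\Rightarrow\mathcal R$, $\models c\mid c':\mathcal R\leadsto_\exists\mathcal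 S$ and $\models\mathcal S\Rightarrow\mathcal Q$, then $\models c\mid c':\mathcal P\leadsto_\exists\mathcal Q$. (eFalse) $\models c\mid c':\mathrm{ff}\leadsto_\exists\mathcal R$.
   Context: Variables come from two disjoint countably infinite sets, of integer and boolean variables. A store is a total function $s$ mapping integer variables to integers and boolean variables to $\{\mathrm{tt},\mathrm{ff}\}$; $\mathsf{Store}$ is the set of stores; $s[x\mapsto n]$ is the update. Expressions are arbitrary total functions $\mathsf{Store}\to\mathbb Z$ or $\mathsf{Store}\to\{\mathrm{tt},\mathrm{ff}\}$; a boolean expression $e$ is identified with the assertion $\{s:e(s)=\mathrm{tt}\}$; $\mathrm{tt},\mathrm{ff}$ also denote constant expressions. Assertions are subsets of $\mathsf{Store}$, relations subsets of $\mathsf{Store}\times\mathsf{Store}$. Connectives on relations denote set operations ($\mathrm{ff}$ is $\emptyset$); $\models\mathcal P\Rightarrow\mathcal Q$ means $\mathcal P\subseteq\mathcal Q$. $[p]_L=\{(s,s'):s\in p\}$, $[p]_R=\{(s,s'):s'\in p\}$; $\mathcal R[x|/e|]=\{(s,s'):(s[x\mapsto e(s)],s')\in\mathcal R\}$, $\mathcal R[|x/|e]=\{(s,s'):(s,s'[x\mapsto e(s')])\in\mathcal R\}$; $\forall x|.\mathcal R=\{(s,s'):(s[x\mapsto v],s')\in\mathcal R$ for all values $v$ of the type of $x\}$; $\exists|x.\mathcal R=\{(s,s'):(s,s'[x\mapsto v])\in\mathcal R$ for some value $v$ of the type of $x\}$. A two-state expression is $E:\mathsf{Store}\times\mathsf{Store}\to\mathbb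 Z$; $(n=E)=\{(s,s'):E(s,s')=n\}$, $(0\le E<n)=\{(s,s'):0\le E(s,s')<n\}$; $(e\doteq e')=\{(s,s'):e(s)=e'(s')\}$. Commands: $c::=\mathsf{skip}\mid x:=e\mid\mathsf{hav}\ x\mid\mathsf{assert}\ p\mid c;c\mid\mathsf{if}\ e\ \mathsf{then}\ c\ \mathsf{else}\ c\mid\mathsf{while}\ e\ \mathsf{do}\ c$ (type-correct). Big-step semantics $c/s\Downarrow\phi$, $\phi\in\mathsf{Store}\cup\{\mathsf{fail}\}$, is the least relation with: $\mathsf{skip}/s\Downarrow s$; $x:=e/s\Downarrow s[x\mapsto e(s)]$; $\mathsf{hav}\ x/s\Downarrow s[x\mapsto n]$ for every value $n$ of the type of $x$; $\mathsf{assert}\ p/s\Downarrow s$ if $s\in p$, $\Downarrow\mathsf{fail}$ otherwise; $c;d/s\Downarrow\mathsf{fail}$ if $c/s\Downarrow\mathsf{fail}$, and $\Downarrow\phi$ if $c/s\Downarrow t$, $d/t\Downarrow\phi$; $\mathsf{if}\ e\ \mathsf{then}\ c\ \mathsf{else}\ d/s\Downarrow\phi$ if ($s\models e$, $c/s\Downarrow\phi$) or ($s\not\models e$, $d/s\Downarrow\phi$); $w=\mathsf{while}\ e\ \mathsf{do}\ c$: $w/s\Downarrow s$ if $s\not\models e$; $w/s\Downarrow\mathsf{fail}$ if $s\models e$ and $c/s\Downarrow\mathsf{fail}$; $w/s\Downarrow\phi$ if $s\models e$, $c/s\Downarrow t$, $w/t\Downarrow\phi$. $\models c\mid c':\mathcal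 R\leadsto_\exists\mathcal S$ means: for all $(s,s')\in\mathcal R$, not $c/s\Downarrow\mathsf{fail}$, and for every $t$ with $c/s\Downarrow t$ there is $t'$ with $c'/s'\Downarrow t'$ and $(t,t')\in\mathcal S$. Kat equivalence $\simeq$ is the least congruence on commands (w.r.t. sequence, if, while) with $\mathsf{skip};c\simeq c$, $c;\mathsf{skip}\simeq c$, $(\mathsf{if}\ \mathrm{tt}\ \mathsf{then}\ c\ \mathsf{else}\ d)\simeq c$, $(\mathsf{while}\ \mathrm{ff}\ \mathsf{do}\ c)\simeq\mathsf{skip}$. *)

theory Defs
  imports Main
begin

text \<open>
  Integer and boolean variables form two disjoint countably infinite types.  Typing of assignments
  and \<open>hav\<close> is intrinsic: commands and substitutions on relations come in an integer (\<open>I\<close>) and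
  a boolean (\<open>B\<close>) variant, so that exactly the type-correct ones exist.
\<close>

datatype ivar = IVar nat
datatype bvar = BVar nat

record store =
  ival :: "ivar \<Rightarrow> int"
  bval :: "bvar \<Rightarrow> bool"

definition updI :: "store \<Rightarrow> ivar \<Rightarrow> int \<Rightarrow> store" where
  "updI s x n = s\<lparr>ival := (ival s)(x := n)\<rparr>"

definition updB :: "store \<Rightarrow> bvar \<Rightarrow> bool \<Rightarrow> store" where
  "updB s x b = s\<lparr>bval := (bval s)(x := b)\<rparr>"

type_synonym iexp = "store \<Rightarrow> int"
type_synonym bexp = "store \<Rightarrow> bool"
type_synonym assn = "store set"
type_synonym srel = "(store \<times> store) set"
type_synonym exp2 = "store \<times> store \<Rightarrow> int"

text \<open>
  Connectives on relations are the set operations, \<open>ff\<close> is \<open>{}\<close>, and validity of an implication is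
  \<open>\<subseteq>\<close>.  A boolean expression is turned into the assertion it denotes by \<open>assn_of\<close>.
\<close>

definition assn_of :: "bexp \<Rightarrow> assn" where
  "assn_of e = {s. e s}"

definition left :: "assn \<Rightarrow> srel" ("[_]\<^sub>L") where
  "[p]\<^sub>L = {(s, s'). s \<in> p}"

definition right :: "assn \<Rightarrow> srel" ("[_]\<^sub>R") where
  "[p]\<^sub>R = {(s, s'). s' \<in> p}"

definition substLI :: "srel \<Rightarrow> ivar \<Rightarrow> iexp \<Rightarrow> srel" where
  "substLI R x e = {(s, s'). (updI s x (e s), s') \<in> R}"

definition substLB :: "srel \<Rightarrow> bvar \<Rightarrow> bexp \<Rightarrow> srel" where
  "substLB R x e = {(s, s'). (updB s x (e s), s') \<in> R}"

definition substRI :: "srel \<Rightarrow> ivar \<Rightarrow> iexp \<Rightarrow> srel" where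
  "substRI R x e = {(s, s'). (s, updI s' x (e s')) \<in> R}"

definition substRB :: "srel \<Rightarrow> bvar \<Rightarrow> bexp \<Rightarrow> srel" where
  "substRB R x e = {(s, s'). (s, updB s' x (e s')) \<in> R}"

definition allLI :: "ivar \<Rightarrow> srel \<Rightarrow> srel" where
  "allLI x R = {(s, s'). \<forall>v. (updI s x v, s') \<in> R}"

definition allLB :: "bvar \<Rightarrow> srel \<Rightarrow> srel" where
  "allLB x R = {(s, s'). \<forall>v. (updB s x v, s') \<in> R}"

definition exRI :: "ivar \<Rightarrow> srel \<Rightarrow> srel" where
  "exRI x R = {(s, s'). \<exists>v. (s, updI s' x v) \<in> R}"

definition exRB :: "bvar \<Rightarrow> srel \<Rightarrow> srel" where
  "exRB x R = {(s, s'). \<exists>v. (s, updB s' x v) \<in> R}"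

definition exp2_eq :: "int \<Rightarrow> exp2 \<Rightarrow> srel" where
  "exp2_eq n E = {(s, s'). E (s, s') = n}"

definition exp2_below :: "exp2 \<Rightarrow> int \<Rightarrow> srel" where
  "exp2_below E n = {(s, s'). 0 \<le> E (s, s') \<and> E (s, s') < n}"

definition agree :: "(store \<Rightarrow> 'v) \<Rightarrow> (store \<Rightarrow> 'v) \<Rightarrow> srel" (infix "\<doteq>" 60) where
  "(e \<doteq> e') = {(s, s'). e s = e' s'}"

datatype com =
    SKIP
  | AsgnI ivar iexp
  | AsgnB bvar bexp
  | HavI ivar
  | HavB bvar
  | Assert assn
  | Seq com com  ("_;;/ _" [101, 100] 100)
  | Cond bexp com com  ("(IF _/ THEN _/ ELSE _)" [0, 0, 100] 100)
  | While bexp com  ("(WHILE _/ DO _)" [0, 100] 100)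

datatype outcome = Final store | Fail

inductive big_step :: "com \<Rightarrow> store \<Rightarrow> outcome \<Rightarrow> bool" ("\<langle>_, _\<rangle> \<Down> _" [0, 0, 51] 50) where
  Skip: "\<langle>SKIP, s\<rangle> \<Down> Final s"
| AsgnI: "\<langle>AsgnI x e, s\<rangle> \<Down> Final (updI s x (e s))"
| AsgnB: "\<langle>AsgnB y b, s\<rangle> \<Down> Final (updB s y (b s))"
| HavI: "\<langle>HavI x, s\<rangle> \<Down> Final (updI s x n)"
| HavB: "\<langle>HavB y, s\<rangle> \<Down> Final (updB s y v)"
| AssertPass: "s \<in> p \<Longrightarrow> \<langle>Assert p, s\<rangle> \<Down> Final s"
| AssertFail: "s \<notin> p \<Longrightarrow> \<langle>Assert p, s\<rangle> \<Down> Fail"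
| SeqFail: "\<langle>c, s\<rangle> \<Down> Fail \<Longrightarrow> \<langle>c;; d, s\<rangle> \<Down> Fail"
| Seq: "\<langle>c, s\<rangle> \<Down> Final t \<Longrightarrow> \<langle>d, t\<rangle> \<Down> \<phi> \<Longrightarrow> \<langle>c;; d, s\<rangle> \<Down> \<phi>"
| IfTrue: "e s \<Longrightarrow> \<langle>c, s\<rangle> \<Down> \<phi> \<Longrightarrow> \<langle>IF e THEN c ELSE d, s\<rangle> \<Down> \<phi>"
| IfFalse: "\<not> e s \<Longrightarrow> \<langle>d, s\<rangle> \<Down> \<phi> \<Longrightarrow> \<langle>IF e THEN c ELSE d, s\<rangle> \<Down> \<phi>"
| WhileDone: "\<not> e s \<Longrightarrow> \<langle>WHILE e DO c, s\<rangle> \<Down> Final s"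
| WhileFail: "e s \<Longrightarrow> \<langle>c, s\<rangle> \<Down> Fail \<Longrightarrow> \<langle>WHILE e DO c, s\<rangle> \<Down> Fail"
| WhileStep: "e s \<Longrightarrow> \<langle>c, s\<rangle> \<Down> Final t \<Longrightarrow> \<langle>WHILE e DO c, t\<rangle> \<Down> \<phi> \<Longrightarrow>
    \<langle>WHILE e DO c, s\<rangle> \<Down> \<phi>"

definition valid_fe :: "com \<Rightarrow> com \<Rightarrow> srel \<Rightarrow> srel \<Rightarrow> bool"
    ("\<Turnstile> _ \<parallel> _ : _ \<leadsto>\<^sub>\<exists> _" [51, 51, 51, 51] 50) where
  "(\<Turnstile> c \<parallel> c' : R \<leadsto>\<^sub>\<exists> S) \<longleftrightarrow>
    (\<forall>(s, s') \<in> R. \<not> \<langle>c, s\<rangle> \<Down> Fail \<and>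
      (\<forall>t. \<langle>c, s\<rangle> \<Down> Final t \<longrightarrow> (\<exists>t'. \<langle>c', s'\<rangle> \<Down> Final t' \<and> (t, t') \<in> S)))"

inductive kat_equiv :: "com \<Rightarrow> com \<Rightarrow> bool" (infix "\<simeq>" 50) where
  refl: "c \<simeq> c"
| sym: "c \<simeq> d \<Longrightarrow> d \<simeq> c"
| trans: "c \<simeq> d \<Longrightarrow> d \<simeq> b \<Longrightarrow> c \<simeq> b"
| Seq_cong: "c \<simeq> c' \<Longrightarrow> d \<simeq> d' \<Longrightarrow> c;; d \<simeq> c';; d'"
| If_cong: "c \<simeq> c' \<Longrightarrow> d \<simeq> d' \<Longrightarrow> IF e THEN c ELSE d \<simeq> IF e THEN c' ELSE d'"
| While_cong: "c \<simeq> c' \<Longrightarrow> WHILE e DO c \<simeq> WHILE e DO c'"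
| skip_Seq: "SKIP;; c \<simeq> c"
| Seq_skip: "c;; SKIP \<simeq> c"
| If_tt: "IF (\<lambda>_. True) THEN c ELSE d \<simeq> c"
| While_ff: "WHILE (\<lambda>_. False) DO c \<simeq> SKIP"

end

theory Submission
  imports Defs
begin

text \<open>
  Only \<open>eDo\<close> and \<open>eRewrite\<close> need an idea.  For \<open>eRewrite\<close>, Kat-equivalent commands
  have the same big-step semantics.  For \<open>eDo\<close>, induct on the terminating run of the left loop.
  From a pair in \<open>Q\<close>, first run the right loop alone as long as \<open>P'\<close> and \<open>e'\<close> hold, which stops
  because \<open>E\<close> decreases and is nonnegative after each such step.  At the pair so reached the side
  condition on \<open>Q\<close> leaves three cases: a step of the left loop alone, a joint step, or both guards
  are false.
\<close>

inductive_cases SkipE: "\<langle>SKIP, s\<rangle> \<Down> \<phi>"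
inductive_cases AsgnIE: "\<langle>AsgnI x e, s\<rangle> \<Down> \<phi>"
inductive_cases AsgnBE: "\<langle>AsgnB y b, s\<rangle> \<Down> \<phi>"
inductive_cases HavIE: "\<langle>HavI x, s\<rangle> \<Down> \<phi>"
inductive_cases HavBE: "\<langle>HavB y, s\<rangle> \<Down> \<phi>"
inductive_cases AssertE: "\<langle>Assert p, s\<rangle> \<Down> \<phi>"
inductive_cases SeqE: "\<langle>c;; d, s\<rangle> \<Down> \<phi>"
inductive_cases IfE: "\<langle>IF e THEN c ELSE d, s\<rangle> \<Down> \<phi>"
inductive_cases WhileE: "\<langle>WHILE e DO c, s\<rangle> \<Down> \<phi>"

lemma valid_fe_not_Fail:
  "\<Turnstile> c \<parallel> c' : R \<leadsto>\<^sub>\<exists> S \<Longrightarrow> (s, s') \<in> R \<Longrightarrow> \<not> \<langle>c, s\<rangle> \<Down> Fail"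
  by (auto simp: valid_fe_def)

lemma valid_fe_Final:
  assumes "\<Turnstile> c \<parallel> c' : R \<leadsto>\<^sub>\<exists> S" "(s, s') \<in> R" "\<langle>c, s\<rangle> \<Down> Final t"
  shows "\<exists>t'. \<langle>c', s'\<rangle> \<Down> Final t' \<and> (t, t') \<in> S"
  using assms by (auto simp: valid_fe_def)

lemma big_step_Skip_iff [simp]: "\<langle>SKIP, s\<rangle> \<Down> \<phi> \<longleftrightarrow> \<phi> = Final s"
  by (auto elim: SkipE intro: big_step.intros)

lemma big_step_AsgnI_iff [simp]: "\<langle>AsgnI x e, s\<rangle> \<Down> \<phi> \<longleftrightarrow> \<phi> = Final (updI s x (e s))"
  by (auto elim: AsgnIE intro: big_step.intros)

lemma big_step_AsgnB_iff [simp]: "\<langle>AsgnB y b, s\<rangle> \<Down> \<phi> \<longleftrightarrow> \<phi> = Final (updB s y (b s))"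
  by (auto elim: AsgnBE intro: big_step.intros)

lemma big_step_HavI_iff [simp]: "\<langle>HavI x, s\<rangle> \<Down> \<phi> \<longleftrightarrow> (\<exists>n. \<phi> = Final (updI s x n))"
  by (auto elim: HavIE intro: big_step.intros)

lemma big_step_HavB_iff [simp]: "\<langle>HavB y, s\<rangle> \<Down> \<phi> \<longleftrightarrow> (\<exists>v. \<phi> = Final (updB s y v))"
  by (auto elim: HavBE intro: big_step.intros)

lemma big_step_Assert_iff [simp]:
  "\<langle>Assert p, s\<rangle> \<Down> \<phi> \<longleftrightarrow> \<phi> = (if s \<in> p then Final s else Fail)"
  by (auto elim: AssertE intro: big_step.intros)

lemma big_step_Seq_iff:
  "\<langle>c;; d, s\<rangle> \<Down> \<phi> \<longleftrightarrow>
    \<phi> = Fail \<and> \<langle>c, s\<rangle> \<Down> Fail \<or> (\<exists>t. \<langle>c, s\<rangle> \<Down> Final t \<and> \<langle>d, t\<rangle> \<Down> \<phi>)"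
  by (auto elim: SeqE intro: big_step.intros)

lemma big_step_If_iff [simp]:
  "\<langle>IF e THEN c ELSE d, s\<rangle> \<Down> \<phi> \<longleftrightarrow> (if e s then \<langle>c, s\<rangle> \<Down> \<phi> else \<langle>d, s\<rangle> \<Down> \<phi>)"
  by (auto elim: IfE intro: big_step.intros)

text \<open>Only one inclusion is shown, by replacing each run of the body inside the run of the
  loop. Used in both directions, it gives the congruence of equivalence under loops.\<close>

lemma big_step_While_mono:
  assumes "\<langle>WHILE e DO c, s\<rangle> \<Down> \<phi>" and "\<And>s \<phi>. \<langle>c, s\<rangle> \<Down> \<phi> \<Longrightarrow> \<langle>d, s\<rangle> \<Down> \<phi>"
  shows "\<langle>WHILE e DO d, s\<rangle> \<Down> \<phi>"
  using assms(1)
  by (induction "WHILE e DO c" s \<phi> rule: big_step.induct) (auto intro: big_step.intros assms(2))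

text \<open>Induction on the derivation of the equivalence. \<open>s\<close> and
  \<open>\<phi>\<close> stay general because the hypotheses are also needed at intermediate
  stores.\<close>

lemma big_step_kat_equiv:
  assumes "c \<simeq> d"
  shows "\<langle>c, s\<rangle> \<Down> \<phi> \<longleftrightarrow> \<langle>d, s\<rangle> \<Down> \<phi>"
  using assms
proof (induction arbitrary: s \<phi>)
  case (While_cong c c' e)
  then show ?case
    by (meson big_step_While_mono)
next
  case (Seq_skip c)
  \<comment> \<open>A failing run of \<open>c;; SKIP\<close> can only come from a failure of
    \<open>c\<close>, a terminating one passes through \<open>SKIP\<close>; hence the split on the
    outcome.\<close>
  then show ?case
    by (cases \<phi>) (auto simp: big_step_Seq_iff)
next
  case (While_ff c)
  then show ?case
    by (auto elim: WhileE intro: big_step.intros)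
qed (auto simp: big_step_Seq_iff)

lemma eSeq:
  assumes "\<Turnstile> c \<parallel> c' : P \<leadsto>\<^sub>\<exists> Q" "\<Turnstile> d \<parallel> d' : Q \<leadsto>\<^sub>\<exists> R"
  shows "\<Turnstile> c;; d \<parallel> c';; d' : P \<leadsto>\<^sub>\<exists> R"
  using assms by (fastforce simp: valid_fe_def big_step_Seq_iff)

lemma eIf4:
  assumes "\<Turnstile> c \<parallel> c' : (Q \<inter> [assn_of e]\<^sub>L \<inter> [assn_of e']\<^sub>R) \<leadsto>\<^sub>\<exists> R"
    and "\<Turnstile> c \<parallel> d' : (Q \<inter> [assn_of e]\<^sub>L \<inter> - [assn_of e']\<^sub>R) \<leadsto>\<^sub>\<exists> R"
    and "\<Turnstile> d \<parallel> c' : (Q \<inter> - [assn_of e]\<^sub>L \<inter> [assn_of e']\<^sub>R) \<leadsto>\<^sub>\<exists> R"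
    and "\<Turnstile> d \<parallel> d' : (Q \<inter> - [assn_of e]\<^sub>L \<inter> - [assn_of e']\<^sub>R) \<leadsto>\<^sub>\<exists> R"
  shows "\<Turnstile> IF e THEN c ELSE d \<parallel> IF e' THEN c' ELSE d' : Q \<leadsto>\<^sub>\<exists> R"
  using assms by (simp add: valid_fe_def left_def right_def assn_of_def) blast

text \<open>The left store \<open>s\<close> stays fixed while the right loop catches up. The last
  conjunct carries outcomes of the loop from \<open>u'\<close> back to \<open>s'\<close>, so
  iterations chain by implication. The loop need not be over at \<open>u'\<close>:
  \<open>e' u'\<close> may hold outside \<open>P'\<close>.\<close>

lemma While_right_steps:
  assumes right: "\<And>n. \<Turnstile> SKIP \<parallel> c' : (Q \<inter> [assn_of e']\<^sub>R \<inter> P' \<inter> exp2_eq n E)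
      \<leadsto>\<^sub>\<exists> (Q \<inter> exp2_below E n)"
    and "(s, s') \<in> Q"
  shows "\<exists>u'. (s, u') \<in> Q \<and> \<not> ((s, u') \<in> P' \<and> e' u') \<and>
    (\<forall>\<phi>. \<langle>WHILE e' DO c', u'\<rangle> \<Down> \<phi> \<longrightarrow> \<langle>WHILE e' DO c', s'\<rangle> \<Down> \<phi>)"
  using assms(2)
proof (induction "nat (E (s, s'))" arbitrary: s' rule: less_induct)
  case less
  show ?case
  proof (cases "(s, s') \<in> P' \<and> e' s'")
    case True
    \<comment> \<open>The judgment is used with \<open>n\<close> equal to the current value of
      \<open>E\<close>.\<close>
    then have pre: "(s, s') \<in> Q \<inter> [assn_of e']\<^sub>R \<inter> P' \<inter> exp2_eq (E (s, s')) E"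
      using less.prems by (simp add: right_def assn_of_def exp2_eq_def)
    \<comment> \<open>\<open>SKIP\<close> always terminates and leaves \<open>s\<close> unchanged,
      so the judgment yields a run of \<open>c'\<close>.\<close>
    obtain t' where t': "\<langle>c', s'\<rangle> \<Down> Final t'" "(s, t') \<in> Q \<inter> exp2_below E (E (s, s'))"
      using valid_fe_Final[OF right pre big_step.Skip] by blast
    \<comment> \<open>The bound 0 \<le> \<open>E (s, t')\<close> matters: it forces
      \<open>E (s, s')\<close> to be positive, so truncation by \<open>nat\<close> keeps the
      inequality strict.\<close>
    then have "nat (E (s, t')) < nat (E (s, s'))"
      by (simp add: exp2_below_def)
    with less.hyps t'(2) obtain u' where
      "(s, u') \<in> Q \<and> \<not> ((s, u') \<in> P' \<and> e' u')"
      and u': "\<And>\<phi>. \<langle>WHILE e' DO c', u'\<rangle> \<Down> \<phi> \<Longrightarrow> \<langle>WHILE e' DO c', t'\<rangle> \<Down> \<phi>"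
      by (metis IntD1)
    moreover have "\<langle>WHILE e' DO c', s'\<rangle> \<Down> \<phi>" if "\<langle>WHILE e' DO c', u'\<rangle> \<Down> \<phi>" for \<phi>
      using True by (intro WhileStep[OF _ t'(1) u'[OF that]]) simp
    ultimately show ?thesis
      by blast
  next
    case False
    with less.prems show ?thesis
      by blast
  qed
qed

lemma eDo:
  assumes left: "\<Turnstile> c \<parallel> SKIP : (Q \<inter> [assn_of e]\<^sub>L \<inter> P) \<leadsto>\<^sub>\<exists> Q"
    and right: "\<forall>n. \<Turnstile> SKIP \<parallel> c' : (Q \<inter> [assn_of e']\<^sub>R \<inter> P' \<inter> exp2_eq n E)
      \<leadsto>\<^sub>\<exists> (Q \<inter> exp2_below E n)"
    and joint: "\<Turnstile> c \<parallel> c' : (Q \<inter> [assn_of e]\<^sub>L \<inter> [assn_of e']\<^sub>R \<inter> - P \<inter> - P') \<leadsto>\<^sub>\<exists> Q"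
    and side: "Q \<subseteq> (e \<doteq> e') \<union> (P \<inter> [assn_of e]\<^sub>L) \<union> (P' \<inter> [assn_of e']\<^sub>R)"
  shows "\<Turnstile> WHILE e DO c \<parallel> WHILE e' DO c' :
    Q \<leadsto>\<^sub>\<exists> (Q \<inter> - [assn_of e]\<^sub>L \<inter> - [assn_of e']\<^sub>R)" (is "\<Turnstile> _ \<parallel> ?w' : Q \<leadsto>\<^sub>\<exists> ?S")
proof -
  \<comment> \<open>One iteration on the left, matched on the right by some iterations alone and
    then at most one joint iteration.\<close>
  have step: "\<not> \<langle>c, s\<rangle> \<Down> Fail \<and>
      (\<forall>t. \<langle>c, s\<rangle> \<Down> Final t \<longrightarrow> (\<exists>t'. (t, t') \<in> Q \<and>
        (\<forall>\<phi>. \<langle>?w', t'\<rangle> \<Down> \<phi> \<longrightarrow> \<langle>?w', s'\<rangle> \<Down> \<phi>)))"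
    if "e s" "(s, s') \<in> Q" for s s'
  proof -
    from While_right_steps[OF spec[OF right] \<open>(s, s') \<in> Q\<close>] obtain u' where
      u': "(s, u') \<in> Q" "\<not> ((s, u') \<in> P' \<and> e' u')"
        "\<And>\<phi>. \<langle>?w', u'\<rangle> \<Down> \<phi> \<Longrightarrow> \<langle>?w', s'\<rangle> \<Down> \<phi>"
      by blast
    show ?thesis
    proof (cases "(s, u') \<in> P")
      case True
      then have "(s, u') \<in> Q \<inter> [assn_of e]\<^sub>L \<inter> P"
        using u' \<open>e s\<close> by (simp add: left_def assn_of_def)
      \<comment> \<open>Here the right side performs \<open>SKIP\<close>, so the witness for
        \<open>t'\<close> is \<open>u'\<close> itself.\<close>
      with left u'(3) show ?thesis
        by (fastforce simp: valid_fe_def)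
    next
      case False
      \<comment> \<open>Two disjuncts of \<open>side\<close> are excluded at \<open>(s, u')\<close>,
        so the guards agree there. Then \<open>e' u'\<close> together with the choice of
        \<open>u'\<close> also puts the pair outside \<open>P'\<close>, as the joint judgment
        requires.\<close>
      with u' side \<open>e s\<close> have "e' u'"
        by (fastforce simp: agree_def left_def right_def assn_of_def)
      with False u' \<open>e s\<close>
      have pre: "(s, u') \<in> Q \<inter> [assn_of e]\<^sub>L \<inter> [assn_of e']\<^sub>R \<inter> - P \<inter> - P'"
        by (simp add: left_def right_def assn_of_def)
      show ?thesis
        using valid_fe_not_Fail[OF joint pre] valid_fe_Final[OF joint pre] u'(3)
          WhileStep[where e = e', OF \<open>e' u'\<close>] by blast
    qed
  qed
  \<comment> \<open>Quantifying over all outcomes \<open>\<phi>\<close> lets a single induction both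
    exclude failure and produce the matching run.\<close>
  have "\<exists>t t'. \<phi> = Final t \<and> \<langle>?w', s'\<rangle> \<Down> Final t' \<and> (t, t') \<in> ?S"
    if "\<langle>WHILE e DO c, s\<rangle> \<Down> \<phi>" "(s, s') \<in> Q" for s s' \<phi>
    using that
  proof (induction "WHILE e DO c" s \<phi> arbitrary: s' rule: big_step.induct)
    case (WhileDone s)
    \<comment> \<open>The left loop is over, but the right one may still have iterations of its own
      to make. After these, \<open>\<not> e s\<close> excludes the left disjunct of
      \<open>side\<close>, and agreement of the guards stops the right loop too.\<close>
    from While_right_steps[OF spec[OF right] \<open>(s, s') \<in> Q\<close>] obtain u' where
      u': "(s, u') \<in> Q" "\<not> ((s, u') \<in> P' \<and> e' u')"
        "\<And>\<phi>. \<langle>?w', u'\<rangle> \<Down> \<phi> \<Longrightarrow> \<langle>?w', s'\<rangle> \<Down> \<phi>"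
      by blast
    with side \<open>\<not> e s\<close> have "\<not> e' u'"
      by (fastforce simp: agree_def left_def right_def assn_of_def)
    with u' \<open>\<not> e s\<close> show ?case
      by (auto simp: left_def right_def assn_of_def intro: big_step.WhileDone)
  next
    case (WhileFail s)
    with step show ?case
      by blast
  next
    case (WhileStep s t \<phi>)
    with step show ?case
      by meson
  qed
  then show ?thesis
    unfolding valid_fe_def by fastforce
qed

lemma eRewrite:
  assumes "\<Turnstile> c \<parallel> c' : Q \<leadsto>\<^sub>\<exists> R" "c \<simeq> d" "c' \<simeq> d'"
  shows "\<Turnstile> d \<parallel> d' : Q \<leadsto>\<^sub>\<exists> R"
  using assms(1) by (simp add: valid_fe_def big_step_kat_equiv[OF assms(2)] big_step_kat_equiv[OF assms(3)])

lemma eConseq: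
  assumes "P \<subseteq> R" "\<Turnstile> c \<parallel> c' : R \<leadsto>\<^sub>\<exists> S" "S \<subseteq> Q"
  shows "\<Turnstile> c \<parallel> c' : P \<leadsto>\<^sub>\<exists> Q"
  using assms unfolding valid_fe_def by blast

theorem theorem3p3:
  fixes c c' d d' :: com
    and P P' Q R S :: srel
    and e e' :: bexp and q :: assn
    and x :: ivar and a :: iexp
    and y :: bvar and b :: bexp
    and E :: exp2
  shows
    \<comment> \<open>eSkip\<close>
    "(\<Turnstile> SKIP \<parallel> SKIP : R \<leadsto>\<^sub>\<exists> R)
    \<comment> \<open>eAsgnSkip\<close>
    \<and> (\<Turnstile> AsgnI x a \<parallel> SKIP : substLI R x a \<leadsto>\<^sub>\<exists> R)
    \<and> (\<Turnstile> AsgnB y b \<parallel> SKIP : substLB R y b \<leadsto>\<^sub>\<exists> R)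
    \<comment> \<open>eSkipAsgn\<close>
    \<and> (\<Turnstile> SKIP \<parallel> AsgnI x a : substRI R x a \<leadsto>\<^sub>\<exists> R)
    \<and> (\<Turnstile> SKIP \<parallel> AsgnB y b : substRB R y b \<leadsto>\<^sub>\<exists> R)
    \<comment> \<open>eHavSkip\<close>
    \<and> (\<Turnstile> HavI x \<parallel> SKIP : allLI x R \<leadsto>\<^sub>\<exists> R)
    \<and> (\<Turnstile> HavB y \<parallel> SKIP : allLB y R \<leadsto>\<^sub>\<exists> R)
    \<comment> \<open>eSkipHav\<close>
    \<and> (\<Turnstile> SKIP \<parallel> HavI x : exRI x R \<leadsto>\<^sub>\<exists> R)
    \<and> (\<Turnstile> SKIP \<parallel> HavB y : exRB y R \<leadsto>\<^sub>\<exists> R)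
    \<comment> \<open>eAsrtSkip\<close>
    \<and> (\<Turnstile> Assert q \<parallel> SKIP : (R \<inter> [q]\<^sub>L) \<leadsto>\<^sub>\<exists> R)
    \<comment> \<open>eSkipAsrt\<close>
    \<and> (\<Turnstile> SKIP \<parallel> Assert q : (R \<inter> [q]\<^sub>R) \<leadsto>\<^sub>\<exists> R)
    \<comment> \<open>eSeq\<close>
    \<and> ((\<Turnstile> c \<parallel> c' : P \<leadsto>\<^sub>\<exists> Q) \<longrightarrow> (\<Turnstile> d \<parallel> d' : Q \<leadsto>\<^sub>\<exists> R) \<longrightarrow>
        (\<Turnstile> c;; d \<parallel> c';; d' : P \<leadsto>\<^sub>\<exists> R))
    \<comment> \<open>eIf4\<close>
    \<and> ((\<Turnstile> c \<parallel> c' : (Q \<inter> [assn_of e]\<^sub>L \<inter> [assn_of e']\<^sub>R) \<leadsto>\<^sub>\<exists> R) \<longrightarrow>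
        (\<Turnstile> c \<parallel> d' : (Q \<inter> [assn_of e]\<^sub>L \<inter> - [assn_of e']\<^sub>R) \<leadsto>\<^sub>\<exists> R) \<longrightarrow>
        (\<Turnstile> d \<parallel> c' : (Q \<inter> - [assn_of e]\<^sub>L \<inter> [assn_of e']\<^sub>R) \<leadsto>\<^sub>\<exists> R) \<longrightarrow>
        (\<Turnstile> d \<parallel> d' : (Q \<inter> - [assn_of e]\<^sub>L \<inter> - [assn_of e']\<^sub>R) \<leadsto>\<^sub>\<exists> R) \<longrightarrow>
        (\<Turnstile> IF e THEN c ELSE d \<parallel> IF e' THEN c' ELSE d' : Q \<leadsto>\<^sub>\<exists> R))
    \<comment> \<open>eDo\<close>
    \<and> ((\<Turnstile> c \<parallel> SKIP : (Q \<inter> [assn_of e]\<^sub>L \<inter> P) \<leadsto>\<^sub>\<exists> Q) \<longrightarrow>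
        (\<forall>n. \<Turnstile> SKIP \<parallel> c' : (Q \<inter> [assn_of e']\<^sub>R \<inter> P' \<inter> exp2_eq n E)
                \<leadsto>\<^sub>\<exists> (Q \<inter> exp2_below E n)) \<longrightarrow>
        (\<Turnstile> c \<parallel> c' : (Q \<inter> [assn_of e]\<^sub>L \<inter> [assn_of e']\<^sub>R \<inter> - P \<inter> - P') \<leadsto>\<^sub>\<exists> Q) \<longrightarrow>
        Q \<subseteq> (e \<doteq> e') \<union> (P \<inter> [assn_of e]\<^sub>L) \<union> (P' \<inter> [assn_of e']\<^sub>R) \<longrightarrow>
        (\<Turnstile> WHILE e DO c \<parallel> WHILE e' DO c' :
           Q \<leadsto>\<^sub>\<exists> (Q \<inter> - [assn_of e]\<^sub>L \<inter> - [assn_of e']\<^sub>R)))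
    \<comment> \<open>eRewrite\<close>
    \<and> ((\<Turnstile> c \<parallel> c' : Q \<leadsto>\<^sub>\<exists> R) \<longrightarrow> c \<simeq> d \<longrightarrow> c' \<simeq> d' \<longrightarrow> (\<Turnstile> d \<parallel> d' : Q \<leadsto>\<^sub>\<exists> R))
    \<comment> \<open>eConseq\<close>
    \<and> (P \<subseteq> R \<longrightarrow> (\<Turnstile> c \<parallel> c' : R \<leadsto>\<^sub>\<exists> S) \<longrightarrow> S \<subseteq> Q \<longrightarrow> (\<Turnstile> c \<parallel> c' : P \<leadsto>\<^sub>\<exists> Q))
    \<comment> \<open>eFalse\<close>
    \<and> (\<Turnstile> c \<parallel> c' : {} \<leadsto>\<^sub>\<exists> R)"
  by (intro conjI impI;
      (erule (3) eDo | erule (3) eIf4 | erule (1) eSeq | erule (2) eRewrite | erule (2) eConseq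
      | auto simp: valid_fe_def substLI_def substLB_def substRI_def substRB_def
          allLI_def allLB_def exRI_def exRB_def left_def right_def))

end
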